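(* Let $a_{1J},a_{2J},a_{3J},b_{1J},b_{2J},b_{3J}\in\mathbb{R}$ for $J\in\{L,R\}$, and consider the family of planar piecewise-linear Filippov systems with parameter $\mu\in\mathbb{R}$ $$\begin{bmatrix}\dot x\\ \dot y\end{bmatrix}=\begin{cases}F_L(x,y;\mu), & x<0,\\ F_R(x,y;\mu), & x>0,\end{cases}\qquad F_J(x,y;\mu)=\begin{bmatrix}a_{1J}x+a_{2J}y+a_{3J}\mu\\ b_{1J}x+b_{2J}y+b_{3J}\mu\end{bmatrix}.$$ Let $A_J=\begin{bmatrix}a_{1J}&a_{2J}\\ b_{1J}&b_{2J}\end{bmatrix}$ and suppose that $A_L$ has eigenvalues $\lambda_L\pm \mathrm{i}\,\omega_L$ with $\lambda_L>0$, $\omega_L>0$, and $A_R$ has eigenvalues $\lambda_R\pm \mathrm{i}\,\omega_R$ with $\lambda_R<0$, $\omega_R>0$. Let $\beta_J=a_{3J}b_{2J}-a_{2J}b_{3J}$ for $J\in\{L,R\}$ and $\gamma=a_{2L}a_{3R}-a_{3L}a_{2R}$, and suppose $\beta_L>0$, $\beta_R>0$, $a_{2L}a_{2R}>0$, and $a_{2L}\gamma\ge0$. Let $$c=(a_{2L}b_{2R}-a_{2R}b_{2L})\gamma,\qquad d_L=a_{2R}^2\beta_L,\qquad d_R=a_{2L}^2\beta_R,$$ and $Q=c^2-2(d_L+d_R)c+(d_L-d_R)^2$. 1. If $c\le|d_L-d_R|$ or $Q<0$, then the system has no admissible pseudo-equilibria for any $\mu\in\mathbb{R}$. 2. If $c>|d_L-d_R|$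 and $Q=0$, then the system has exactly one admissible pseudo-equilibrium for all $\mu\ne0$; if $c>|d_L-d_R|$ and $Q>0$, then the system has exactly two admissible pseudo-equilibria for all $\mu\neq0$.
   Context: Write $f_J$ and $g_J$ for the first and second components of $F_J$. An attracting sliding region is a subset of $x=0$ on which $f_L>0$ and $f_R<0$; a repelling sliding region is a subset of $x=0$ on which $f_L<0$ and $f_R>0$. On sliding regions, orbits are governed by Filippov's sliding vector field $$\dot y=g_{\rm slide}(y;\mu)=\left.\frac{f_Lg_R-f_Rg_L}{f_L-f_R}\right|_{x=0},$$ the convex combination of $F_L$ and $F_R$ that is tangent to $x=0$. Pseudo-equilibria are the points $(0,y)$ where $y$ is a root of $$h(y;\mu)=f_L(0,y;\mu)\,g_R(0,y;\mu)-f_R(0,y;\mu)\,g_L(0,y;\mu).$$ A pseudo-equilibrium is called admissible if it belongs to a sliding region (attracting or repelling). Pseudo-equilibria are counted as distinct points. *)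

theory Defs
  imports "Jordan_Normal_Form.Spectral_Radius"
begin

type_synonym planar_field = "real \<times> real \<Rightarrow> real \<times> real"

definition linear_field ::
    "real \<Rightarrow> real \<Rightarrow> real \<Rightarrow> real \<Rightarrow> real \<Rightarrow> real \<Rightarrow> real \<Rightarrow> planar_field" where
  "linear_field a1 a2 a3 b1 b2 b3 \<mu> =
     (\<lambda>(x, y). (a1 * x + a2 * y + a3 * \<mu>, b1 * x + b2 * y + b3 * \<mu>))"

definition switching_line :: "(real \<times> real) set" where
  "switching_line = {(x, y). x = 0}"

text \<open>In the following definitions, \<open>FL\<close> and \<open>FR\<close> are the vector fields of a Filippov system
  with switching line \<open>x = 0\<close>, for \<open>x < 0\<close> and \<open>x > 0\<close> respectively, at a fixed value of the
  parameter.\<close>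

definition attracting_sliding_region ::
    "planar_field \<Rightarrow> planar_field \<Rightarrow> (real \<times> real) set \<Rightarrow> bool" where
  "attracting_sliding_region FL FR S \<longleftrightarrow>
     S \<subseteq> switching_line \<and> (\<forall>p\<in>S. fst (FL p) > 0 \<and> fst (FR p) < 0)"

definition repelling_sliding_region ::
    "planar_field \<Rightarrow> planar_field \<Rightarrow> (real \<times> real) set \<Rightarrow> bool" where
  "repelling_sliding_region FL FR S \<longleftrightarrow>
     S \<subseteq> switching_line \<and> (\<forall>p\<in>S. fst (FL p) < 0 \<and> fst (FR p) > 0)"

text \<open>The numerator of Filippov's sliding vector field
  \<open>(f\<^sub>L g\<^sub>R - f\<^sub>R g\<^sub>L) / (f\<^sub>L - f\<^sub>R)\<close> on \<open>x = 0\<close>.\<close>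

definition sliding_numerator :: "planar_field \<Rightarrow> planar_field \<Rightarrow> real \<Rightarrow> real" where
  "sliding_numerator FL FR y =
     fst (FL (0, y)) * snd (FR (0, y)) - fst (FR (0, y)) * snd (FL (0, y))"

definition pseudo_equilibria :: "planar_field \<Rightarrow> planar_field \<Rightarrow> (real \<times> real) set" where
  "pseudo_equilibria FL FR = {(0, y) | y. sliding_numerator FL FR y = 0}"

definition admissible_pseudo_equilibria ::
    "planar_field \<Rightarrow> planar_field \<Rightarrow> (real \<times> real) set" where
  "admissible_pseudo_equilibria FL FR =
     {p \<in> pseudo_equilibria FL FR.
        \<exists>S. (attracting_sliding_region FL FR S \<or> repelling_sliding_region FL FR S) \<and> p \<in> S}"

definition complex_eigenvalues :: "real mat \<Rightarrow> complex set" where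
  "complex_eigenvalues A = spectrum (map_mat complex_of_real A)"

end

theory Submission
  imports Defs "HOL-Library.Quadratic_Discriminant"
begin

text \<open>For \<open>\<mu> \<gamma> \<noteq> 0\<close> the point \<open>(0, y)\<close> is described by the coordinate \<open>s\<close> with
  \<open>a\<^sub>2\<^sub>R f\<^sub>L = - s \<gamma> \<mu>\<close> and \<open>a\<^sub>2\<^sub>L f\<^sub>R = (1 - s) \<gamma> \<mu>\<close>; since \<open>a\<^sub>2\<^sub>L a\<^sub>2\<^sub>R > 0\<close>, it lies in a sliding region iff
  \<open>0 < s < 1\<close>. In this coordinate the equation \<open>h = 0\<close> becomes \<open>c s (1 - s) = d\<^sub>R s + d\<^sub>L (1 - s)\<close>,
  a quadratic equation in \<open>s\<close> with discriminant \<open>Q\<close>. If \<open>\<mu> \<gamma> = 0\<close>, then \<open>f\<^sub>L\<close> and \<open>f\<^sub>R\<close> never have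
  opposite signs on \<open>x = 0\<close>.\<close>

section \<open>Admissibility as a sign condition on the switching line\<close>

lemma admissible_pseudo_equilibria_iff:
  "p \<in> admissible_pseudo_equilibria FL FR \<longleftrightarrow>
     (\<exists>y. p = (0, y) \<and> sliding_numerator FL FR y = 0 \<and> fst (FL (0, y)) * fst (FR (0, y)) < 0)"
proof -
  have "(\<exists>S. (attracting_sliding_region FL FR S \<or> repelling_sliding_region FL FR S) \<and> (0, y) \<in> S)
      \<longleftrightarrow> fst (FL (0, y)) * fst (FR (0, y)) < 0" (is "?L \<longleftrightarrow> ?R") for y
  proof
    assume ?L
    then show ?R
      by (auto simp: attracting_sliding_region_def repelling_sliding_region_def mult_less_0_iff)
  next
    assume ?R
    \<comment> \<open>Any subset of the line with the right signs counts as a region, so the point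
      alone serves as one.\<close>
    then have "attracting_sliding_region FL FR {(0, y)} \<or> repelling_sliding_region FL FR {(0, y)}"
      by (auto simp: attracting_sliding_region_def repelling_sliding_region_def
          switching_line_def mult_less_0_iff)
    then show ?L by blast
  qed
  then show ?thesis
    unfolding admissible_pseudo_equilibria_def pseudo_equilibria_def by auto
qed

section \<open>Roots of the quadratic equation in the open unit interval\<close>

definition sliding_roots :: "real \<Rightarrow> real \<Rightarrow> real \<Rightarrow> real set" where
  "sliding_roots c dL dR = {s. 0 < s \<and> s < 1 \<and> c * s * (1 - s) = dR * s + dL * (1 - s)}"

text \<open>The right-hand side of the equation is positive for \<open>0 < s < 1\<close>, which
  forces \<open>c > 0\<close>. Each half of the bound on \<open>c\<close> then follows by writing
  its difference, times a positive factor, as a sum of positive terms; a real root excludes a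
  negative discriminant.\<close>

lemma sliding_roots_nonempty_imp:
  fixes c dL dR s :: real
  assumes "dL > 0" and "dR > 0" and "s \<in> sliding_roots c dL dR"
  shows "c > \<bar>dL - dR\<bar>" and "discrim c (dR - dL - c) dL \<ge> 0"
proof -
  have s: "0 < s" "s < 1" and eq: "c * s * (1 - s) = dR * s + dL * (1 - s)"
    using assms by (auto simp: sliding_roots_def)
  have "dR * s > 0" "dL * (1 - s) > 0"
    using assms s by auto
  then have "c * (s * (1 - s)) > 0"
    using eq by (simp add: mult.assoc)
  moreover have "s * (1 - s) > 0"
    using s by simp
  ultimately have c: "c > 0"
    by (simp add: zero_less_mult_iff)
  have "(c - (dL - dR)) * (1 - s) = c * (1 - s)\<^sup>2 + dR"
    using eq by (simp add: algebra_simps power2_eq_square)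
  then have "(c - (dL - dR)) * (1 - s) > 0"
    using c assms by (simp add: add_nonneg_pos)
  then have 1: "c > dL - dR"
    using s by (simp add: zero_less_mult_iff)
  \<comment> \<open>Mirror image of the previous bound: the equation is invariant under exchanging
    \<open>s\<close> with \<open>1 - s\<close> and \<open>dL\<close> with \<open>dR\<close>.\<close>
  have "(c - (dR - dL)) * s = c * s\<^sup>2 + dL"
    using eq by (simp add: algebra_simps power2_eq_square)
  then have "(c - (dR - dL)) * s > 0"
    using c assms by (simp add: add_nonneg_pos)
  then have "c > dR - dL"
    using s by (simp add: zero_less_mult_iff)
  with 1 show "c > \<bar>dL - dR\<bar>" by linarith
  have "c * s\<^sup>2 + (dR - dL - c) * s + dL = 0"
    using eq by (simp add: algebra_simps power2_eq_square)
  then show "discrim c (dR - dL - c) dL \<ge> 0"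
    using c discriminant_negative[of c "dR - dL - c" dL s] by force
qed

text \<open>The quadratic formula gives the two candidates. The smaller one is positive iff
  \<open>r < c + dL - dR\<close>, and the larger one is below 1 iff
  \<open>r < c - dL + dR\<close>.\<close>

lemma sliding_roots_eq:
  fixes c dL dR :: real
  assumes "dL > 0" and "dR > 0" and "c > \<bar>dL - dR\<bar>"
    and disc: "discrim c (dR - dL - c) dL \<ge> 0"
  defines "r \<equiv> sqrt (discrim c (dR - dL - c) dL)"
  shows "sliding_roots c dL dR = {(c + dL - dR + r) / (2 * c), (c + dL - dR - r) / (2 * c)}"
proof -
  have c: "c > 0" using assms by linarith
  have r0: "r \<ge> 0" and r2: "r\<^sup>2 = (dR - dL - c)\<^sup>2 - 4 * c * dL"
    using disc by (auto simp: r_def discrim_def)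
  \<comment> \<open>The discriminant is symmetric in \<open>dL\<close> and \<open>dR\<close>, so it
    lies below the square of either bound wanted for \<open>r\<close>.\<close>
  have "r\<^sup>2 = (c + dL - dR)\<^sup>2 - 4 * (c * dL)" "r\<^sup>2 = (c - dL + dR)\<^sup>2 - 4 * (c * dR)"
    unfolding r2 by (simp_all add: algebra_simps power2_eq_square)
  moreover have "c * dL > 0" "c * dR > 0"
    using c assms by auto
  ultimately have "r\<^sup>2 < (c + dL - dR)\<^sup>2" "r\<^sup>2 < (c - dL + dR)\<^sup>2"
    by linarith+
  \<comment> \<open>Squares may be compared because \<open>c > \<bar>dL - dR\<bar>\<close> makes
    both bounds positive.\<close>
  then have "r < c + dL - dR" "r < c - dL + dR"
    using assms by (auto intro: power2_less_imp_less)
  then have bounds: "0 < (c + dL - dR + r) / (2 * c)" "(c + dL - dR + r) / (2 * c) < 1"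
      "0 < (c + dL - dR - r) / (2 * c)" "(c + dL - dR - r) / (2 * c) < 1"
    using c r0 by (auto simp: field_simps)
  have "c * s * (1 - s) = dR * s + dL * (1 - s) \<longleftrightarrow>
      s = (c + dL - dR + r) / (2 * c) \<or> s = (c + dL - dR - r) / (2 * c)" for s
  proof -
    have "c * s * (1 - s) = dR * s + dL * (1 - s) \<longleftrightarrow> c * s\<^sup>2 + (dR - dL - c) * s + dL = 0"
      by (auto simp: algebra_simps power2_eq_square)
    also have "\<dots> \<longleftrightarrow> s = (c + dL - dR + r) / (2 * c) \<or> s = (c + dL - dR - r) / (2 * c)"
      using c disc discriminant_iff[of c s "dR - dL - c" dL] by (simp add: r_def algebra_simps)
    finally show ?thesis .
  qed
  then show ?thesis
    unfolding sliding_roots_def using bounds by auto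
qed

lemma card_sliding_roots:
  fixes c dL dR :: real
  assumes "dL > 0" and "dR > 0" and "c > \<bar>dL - dR\<bar>"
    and "discrim c (dR - dL - c) dL \<ge> 0"
  shows "card (sliding_roots c dL dR) = (if discrim c (dR - dL - c) dL = 0 then 1 else 2)"
proof -
  have "c > 0" using assms by linarith
  then show ?thesis
    unfolding sliding_roots_eq[OF assms] by (auto simp: card_insert_if field_simps)
qed

section \<open>The coordinate \<open>s\<close> on the switching line at a fixed parameter
  value\<close>

locale linear_filippov =
  fixes a1L a2L a3L b1L b2L b3L a1R a2R a3R b1R b2R b3R \<mu> :: real
  assumes a2_same_sign: "a2L * a2R > 0"
begin

abbreviation "fieldL \<equiv> linear_field a1L a2L a3L b1L b2L b3L \<mu>"
abbreviation "fieldR \<equiv> linear_field a1R a2R a3R b1R b2R b3R \<mu>"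
abbreviation "gam \<equiv> a2L * a3R - a3L * a2R"
abbreviation "cc \<equiv> (a2L * b2R - a2R * b2L) * gam"
abbreviation "dl \<equiv> a2R\<^sup>2 * (a3L * b2L - a2L * b3L)"
abbreviation "dr \<equiv> a2L\<^sup>2 * (a3R * b2R - a2R * b3R)"

text \<open>The solution \<open>y\<close> of
  \<open>a2R * (a2L * y + a3L * \<mu>) = - s * gam * \<mu>\<close>.\<close>

abbreviation slide_coord :: "real \<Rightarrow> real" where
  "slide_coord s \<equiv> - (s * gam * \<mu> / a2R + a3L * \<mu>) / a2L"

lemma a2_nonzero: "a2L \<noteq> 0" "a2R \<noteq> 0"
  using a2_same_sign by auto

text \<open>On \<open>x = 0\<close> the difference of \<open>a2L\<close> times the right and
  \<open>a2R\<close> times the left first component is the constant \<open>gam * \<mu>\<close>. If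
  it vanishes, the product of the components times \<open>a2L * a2R > 0\<close> is a square.\<close>

lemma no_admissible_degenerate:
  assumes "gam * \<mu> = 0"
  shows "admissible_pseudo_equilibria fieldL fieldR = {}"
proof -
  have "\<not> (a2L * y + a3L * \<mu>) * (a2R * y + a3R * \<mu>) < 0" for y
  proof -
    have eq: "a2R * (a2L * y + a3L * \<mu>) = a2L * (a2R * y + a3R * \<mu>)"
      using assms by (auto simp: algebra_simps)
    have "(a2L * a2R) * ((a2L * y + a3L * \<mu>) * (a2R * y + a3R * \<mu>))
        = (a2R * (a2L * y + a3L * \<mu>)) * (a2L * (a2R * y + a3R * \<mu>))"
      by (simp only: ac_simps)
    also have "\<dots> = (a2L * (a2R * y + a3R * \<mu>))\<^sup>2"
      by (simp only: eq power2_eq_square)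
    finally have "(a2L * a2R) * ((a2L * y + a3L * \<mu>) * (a2R * y + a3R * \<mu>))
        = (a2L * (a2R * y + a3R * \<mu>))\<^sup>2" .
    then have "0 \<le> (a2L * a2R) * ((a2L * y + a3L * \<mu>) * (a2R * y + a3R * \<mu>))"
      by simp
    then show ?thesis
      using a2_same_sign by (simp only: zero_le_mult_iff[of "a2L * a2R"]) simp
  qed
  then show ?thesis
    by (auto simp: admissible_pseudo_equilibria_iff linear_field_def)
qed

lemma admissible_at_slide_coord:
  assumes "gam * \<mu> \<noteq> 0"
  shows "(0, slide_coord s) \<in> admissible_pseudo_equilibria fieldL fieldR \<longleftrightarrow>
    s \<in> sliding_roots cc dl dr"
proof -
  define y where "y = slide_coord s"
  define u where "u = a2L * y + a3L * \<mu>"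
  define v where "v = a2R * y + a3R * \<mu>"
  define h where "h = u * (b2R * y + b3R * \<mu>) - v * (b2L * y + b3L * \<mu>)"
  have u: "a2R * u = - s * (gam * \<mu>)"
    unfolding u_def y_def using a2_nonzero by (simp add: field_simps)
  have "a2L * v = a2R * u + gam * \<mu>"
    unfolding u_def v_def by (simp add: algebra_simps)
  then have v: "a2L * v = (1 - s) * (gam * \<mu>)"
    unfolding u by (simp add: algebra_simps)
  have "(a2L * a2R) * (u * v) = (a2R * u) * (a2L * v)"
    by simp
  also have "\<dots> = - ((gam * \<mu>)\<^sup>2 * (s * (1 - s)))"
    unfolding u v by (simp add: algebra_simps power2_eq_square)
  finally have "(a2L * a2R) * (u * v) = - ((gam * \<mu>)\<^sup>2 * (s * (1 - s)))" .
  moreover have "u * v < 0 \<longleftrightarrow> (a2L * a2R) * (u * v) < 0"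
    using a2_same_sign by (simp only: mult_less_0_iff[of "a2L * a2R"]) simp
  moreover have "(gam * \<mu>)\<^sup>2 > 0"
    unfolding zero_less_power2 by (fact assms)
  ultimately have uv: "u * v < 0 \<longleftrightarrow> 0 < s \<and> s < 1"
    by (auto simp: zero_less_mult_iff)
  \<comment> \<open>With \<open>g\<close> the second component of a field,
    \<open>a2R * gR = b2R * v - betaR * \<mu>\<close> and
    \<open>a2L * gL = b2L * u - betaL * \<mu>\<close>; inserting these in \<open>h\<close> leaves an
    expression in \<open>u\<close> and \<open>v\<close> alone.\<close>
  have "(a2L * a2R)\<^sup>2 * gam * h
      = cc * ((a2R * u) * (a2L * v)) - gam * \<mu> * (dr * (a2R * u) - dl * (a2L * v))"
    unfolding h_def u_def v_def by (simp add: algebra_simps power2_eq_square)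
  also have "\<dots> = (gam * \<mu>)\<^sup>2 * (dr * s + dl * (1 - s) - cc * s * (1 - s))"
    unfolding u v by (simp add: algebra_simps power2_eq_square)
  finally have eq: "(a2L * a2R)\<^sup>2 * gam * h
      = (gam * \<mu>)\<^sup>2 * (dr * s + dl * (1 - s) - cc * s * (1 - s))" .
  have "h = 0 \<longleftrightarrow> (a2L * a2R)\<^sup>2 * gam * h = 0"
    using a2_nonzero assms by simp
  also have "\<dots> \<longleftrightarrow> cc * s * (1 - s) = dr * s + dl * (1 - s)"
    unfolding eq using assms by auto
  finally show ?thesis
    using uv unfolding y_def[symmetric]
    by (auto simp: admissible_pseudo_equilibria_iff linear_field_def sliding_numerator_def
        sliding_roots_def u_def v_def h_def)
qed

text \<open>The map from \<open>s\<close> to \<open>y\<close> is affine with nonzero slope, so it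
  reaches each point of the line exactly once.\<close>

lemma admissible_bij_sliding_roots:
  assumes "gam * \<mu> \<noteq> 0"
  shows "bij_betw (\<lambda>s. (0, slide_coord s)) (sliding_roots cc dl dr)
    (admissible_pseudo_equilibria fieldL fieldR)"
proof (rule bij_betw_imageI)
  show "inj_on (\<lambda>s. (0::real, slide_coord s)) (sliding_roots cc dl dr)"
    using assms a2_nonzero by (intro inj_onI) auto
  have "p \<in> (\<lambda>s. (0, slide_coord s)) ` sliding_roots cc dl dr"
    if p: "p \<in> admissible_pseudo_equilibria fieldL fieldR" for p
  proof -
    obtain y where y: "p = (0, y)"
      using p by (auto simp: admissible_pseudo_equilibria_iff)
    define s where "s = - a2R * (a2L * y + a3L * \<mu>) / (gam * \<mu>)"
    have "s * gam * \<mu> = - a2R * (a2L * y + a3L * \<mu>)"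
      using assms unfolding s_def by simp
    then have "y = slide_coord s"
      using a2_nonzero by simp
    then show ?thesis
      using p y admissible_at_slide_coord[OF assms, of s] by auto
  qed
  then show "(\<lambda>s. (0, slide_coord s)) ` sliding_roots cc dl dr
      = admissible_pseudo_equilibria fieldL fieldR"
    using admissible_at_slide_coord[OF assms] by blast
qed

end

theorem proposition4p1:
  fixes a1L a2L a3L b1L b2L b3L a1R a2R a3R b1R b2R b3R :: real
    and lamL omegaL lamR omegaR betaL betaR gamma c dL dR Q :: real
    and FL FR :: "real \<Rightarrow> planar_field"
    and AL AR :: "real mat"
  assumes "FL = linear_field a1L a2L a3L b1L b2L b3L"
    and "FR = linear_field a1R a2R a3R b1R b2R b3R"
    and "AL = mat_of_rows_list 2 [[a1L, a2L], [b1L, b2L]]"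
    and "AR = mat_of_rows_list 2 [[a1R, a2R], [b1R, b2R]]"
    and "complex_eigenvalues AL = {Complex lamL omegaL, Complex lamL (- omegaL)}"
    and "lamL > 0" and "omegaL > 0"
    and "complex_eigenvalues AR = {Complex lamR omegaR, Complex lamR (- omegaR)}"
    and "lamR < 0" and "omegaR > 0"
    and "betaL = a3L * b2L - a2L * b3L"
    and "betaR = a3R * b2R - a2R * b3R"
    and "gamma = a2L * a3R - a3L * a2R"
    and "betaL > 0" and "betaR > 0"
    and "a2L * a2R > 0" and "a2L * gamma \<ge> 0"
    and "c = (a2L * b2R - a2R * b2L) * gamma"
    and "dL = a2R\<^sup>2 * betaL"
    and "dR = a2L\<^sup>2 * betaR"
    and "Q = c\<^sup>2 - 2 * (dL + dR) * c + (dL - dR)\<^sup>2"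
  shows "(c \<le> \<bar>dL - dR\<bar> \<or> Q < 0 \<longrightarrow>
            (\<forall>\<mu>. admissible_pseudo_equilibria (FL \<mu>) (FR \<mu>) = {})) \<and>
         (c > \<bar>dL - dR\<bar> \<and> Q = 0 \<longrightarrow>
            (\<forall>\<mu>. \<mu> \<noteq> 0 \<longrightarrow> card (admissible_pseudo_equilibria (FL \<mu>) (FR \<mu>)) = 1)) \<and>
         (c > \<bar>dL - dR\<bar> \<and> Q > 0 \<longrightarrow>
            (\<forall>\<mu>. \<mu> \<noteq> 0 \<longrightarrow> card (admissible_pseudo_equilibria (FL \<mu>) (FR \<mu>)) = 2))"
proof -
  have "a2L \<noteq> 0" "a2R \<noteq> 0"
    using \<open>a2L * a2R > 0\<close> by auto
  then have d: "dL > 0" "dR > 0"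
    unfolding \<open>dL = _\<close> \<open>dR = _\<close> using \<open>betaL > 0\<close> \<open>betaR > 0\<close> by simp_all
  have Q: "Q = discrim c (dR - dL - c) dL"
    unfolding \<open>Q = _\<close> discrim_def by (simp add: algebra_simps power2_eq_square)
  note defs = \<open>FL = _\<close> \<open>FR = _\<close> \<open>betaL = _\<close> \<open>betaR = _\<close> \<open>gamma = _\<close> \<open>c = _\<close> \<open>dL = _\<close> \<open>dR = _\<close>
  have loc: "linear_filippov a2L a2R"
    using \<open>a2L * a2R > 0\<close> by (simp add: linear_filippov_def)
  have degenerate: "admissible_pseudo_equilibria (FL \<mu>) (FR \<mu>) = {}" if "gamma * \<mu> = 0" for \<mu>
    using that unfolding defs by (rule linear_filippov.no_admissible_degenerate[OF loc])
  have bij: "\<exists>f. bij_betw f (sliding_roots c dL dR) (admissible_pseudo_equilibria (FL \<mu>) (FR \<mu>))"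
    if "gamma * \<mu> \<noteq> 0" for \<mu>
    using that unfolding defs
    by (intro exI) (rule linear_filippov.admissible_bij_sliding_roots[OF loc])
  have "admissible_pseudo_equilibria (FL \<mu>) (FR \<mu>) = {}" if "c \<le> \<bar>dL - dR\<bar> \<or> Q < 0" for \<mu>
  \<comment> \<open>The degenerate case includes \<open>\<mu> = 0\<close>, where the coordinate
    \<open>s\<close> is undefined.\<close>
  proof (cases "gamma * \<mu> = 0")
    case False
    have "sliding_roots c dL dR = {}"
      using sliding_roots_nonempty_imp[OF d] that unfolding Q by force
    then show ?thesis
      using bij[OF False] by (auto simp: bij_betw_def)
  qed (rule degenerate)
  moreover have "card (admissible_pseudo_equilibria (FL \<mu>) (FR \<mu>)) = (if Q = 0 then 1 else 2)"
    if "c > \<bar>dL - dR\<bar>" "Q \<ge> 0" "\<mu> \<noteq> 0" for \<mu>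
  proof -
    \<comment> \<open>\<open>gamma\<close> is a factor of \<open>c\<close>, and
      \<open>c > \<bar>dL - dR\<bar>\<close> makes \<open>c\<close> positive.\<close>
    have "gamma \<noteq> 0"
      using that \<open>c = _\<close> by auto
    then obtain f where "bij_betw f (sliding_roots c dL dR) (admissible_pseudo_equilibria (FL \<mu>) (FR \<mu>))"
      using bij[of \<mu>] \<open>\<mu> \<noteq> 0\<close> by auto
    from bij_betw_same_card[OF this] show ?thesis
      using card_sliding_roots[OF d] that unfolding Q by simp
  qed
  ultimately show ?thesis
    by simp
qed

end
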